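(* Let $\mathbf W_h\in(V_h^K)^s$ be a discrete function whose integrated fluxes and source satisfy, at all nodes of the mesh (equivalently, on all of $\Omega$), $$\mathcal F_{1,h}(\mathbf x)+\mathcal F_{2,h}(\mathbf x)+\mathcal S_h(\mathbf x)=\mathbf f_h(x^1)+\mathbf g_h(x^2)$$ with the particular choice $$\mathbf g_h(x^2)=\mathcal F_{1,h}(x^1_0,x^2),\qquad \mathbf f_h(x^1)=\mathcal F_{2,h}(x^1,x^2_0).$$ Then in every element $E_{ij}$ of the mesh the array of integrated divergence and source vanishes: $\Psi^{ij}_{pq}+\mathcal S^{ij}_{pq}=0$ for all $p,q=0,\dots,K$, i.e. $$\int_{x^2_{j,0}}^{x^2_{j,q}}\int_{x^1_{i,0}}^{x^1_{i,p}}\big(\nabla\cdot\mathbf F_h-\mathbf S_h\big)\,dx^1dx^2=0 .$$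
   Context: Mesh and space. $\Omega=[x^1_0,x^1_0+L_1]\times[x^2_0,x^2_0+L_2]$ is divided into $N_1\times N_2$ elements $E_{ij}=[x^1_i,x^1_{i+1}]\times[x^2_j,x^2_{j+1}]$ with uniform sizes $h_m=L_m/N_m$. Fix $K\ge1$. In every one-dimensional cell take the $K+1$ Gauss--Lobatto points $x^m_{\ell,0}=x^m_\ell<\dots<x^m_{\ell,K}=x^m_{\ell+1}$. $V_h^K$ is the space of continuous functions on $\Omega$ whose restriction to each element is in $\mathbb Q^K$ (degree at most $K$ in each variable). Its nodes $\mathbf x_\alpha$ are the tensor products of the one-dimensional points. Potentials. For the balance law $\partial_t\mathbf W+\nabla\cdot\mathbf F(\mathbf W)=\mathbf S(\mathbf W;\mathbf x)$, $\mathbf F=(\mathbf F_1,\mathbf F_2)$, and $\mathbf W_h$ with nodal values $\mathbf W_\alpha$, let $\mathbf F_h=(\mathbf F_{1,h},\mathbf F_{2,h})$ and $\mathbf S_h$ be the nodal interpolants in $V_h^K$ (component-wise) of $\mathbf F_m(\mathbf W_\alpha)$ and $\mathbf S(\mathbf W_\alpha;\mathbf x_\alpha)$. $\mathcal F_{1,h},\mathcal F_{2,h},\mathcal S_h\in(V_h^K)^s$ are defined by their values at every node $(a,b)$: $\mathcal F_{1,h}(a,b)=\int_{x^2_0}^{b}\mathbf F_{1,h}(a,\eta)d\eta$, $\mathcal F_{2,h}(a,b)=\int_{x^1_0}^{a}\mathbf F_{2,h}(\xi,b)d\xi$, $\mathcal S_h(a,b)=-\int_{x^1_0}^{a}\int_{x^2_0}^{b}\mathbf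 S_h\,d\eta d\xi$. Element arrays: $$\Psi^{ij}_{pq}=\int_{x^2_{j,0}}^{x^2_{j,q}}\int_{x^1_{i,0}}^{x^1_{i,p}}\nabla\cdot\mathbf F_h\,dx^1dx^2,\qquad \mathcal S^{ij}_{pq}=-\int_{x^2_{j,0}}^{x^2_{j,q}}\int_{x^1_{i,0}}^{x^1_{i,p}}\mathbf S_h\,dx^1dx^2 ,$$ the latter being the source potential of the element with its integration constants set to zero. *)

theory Defs
  imports "HOL-Analysis.Analysis" "HOL-Computational_Algebra.Polynomial"
begin

text \<open>Rodrigues' formula.\<close>

definition legendre :: "nat \<Rightarrow> real poly" where
  "legendre n = smult (1 / (2 ^ n * fact n)) ((pderiv ^^ n) ([:-1, 0, 1:] ^ n))"

text \<open>The \<open>K + 1\<close> Gauss--Lobatto points on \<open>[-1, 1]\<close>: the end points and the zeros of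
  the derivative of the Legendre polynomial of degree \<open>K\<close>, in increasing order.\<close>

definition gauss_lobatto_set :: "nat \<Rightarrow> real set" where
  "gauss_lobatto_set K = {-1, 1} \<union> {x. poly (pderiv (legendre K)) x = 0}"

definition gauss_lobatto :: "nat \<Rightarrow> nat \<Rightarrow> real" where
  "gauss_lobatto K k = sorted_list_of_set (gauss_lobatto_set K) ! k"

lemma rolle_roots:
  fixes p :: "real poly"
  assumes "finite A" "card A = Suc m" "\<forall>a\<in>A. poly p a = 0"
  shows "\<exists>B. finite B \<and> card B = m \<and> (\<forall>b\<in>B. poly (pderiv p) b = 0 \<and> Min A < b \<and> b < Max A)"
  using assms
proof (induction m arbitrary: A)
  case 0
  then show ?case by (intro exI[of _ "{}"]) auto
next
  case (Suc m)
  define A' where "A' = A - {Max A}"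
  have ne: "A \<noteq> {}" using Suc.prems by auto
  have M: "Max A \<in> A" using ne Suc.prems by simp
  have fA': "finite A'" and cA': "card A' = Suc m"
    using Suc.prems M by (auto simp: A'_def)
  have ne': "A' \<noteq> {}" using cA' by auto
  obtain B where B: "finite B" "card B = m"
    "\<forall>b\<in>B. poly (pderiv p) b = 0 \<and> Min A' < b \<and> b < Max A'"
    using Suc.IH[OF fA' cA'] Suc.prems by (auto simp: A'_def)
  have M': "Max A' \<in> A'" using fA' ne' by simp
  have lt: "Max A' < Max A"
    using M' Suc.prems(1) by (metis A'_def DiffD1 DiffD2 Max_ge insertCI order_le_less)
  have "Min A \<le> Min A'"
    by (rule Min_antimono) (use ne' Suc.prems in \<open>auto simp: A'_def\<close>)
  moreover have "Min A' \<le> Max A'" using fA' ne' by simp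
  moreover obtain z where z: "Max A' < z" "z < Max A" "poly (pderiv p) z = 0"
  proof -
    have "poly p (Max A') = poly p (Max A)"
      using M M' Suc.prems by (auto simp: A'_def)
    then have "\<exists>z. Max A' < z \<and> z < Max A \<and> DERIV (poly p) z :> 0"
      using lt by (intro Rolle) (auto simp: real_differentiable_def intro!: continuous_intros poly_DERIV)
    then show ?thesis
      using that by (meson DERIV_unique poly_DERIV)
  qed
  moreover have "z \<notin> B" using B z by force
  ultimately show ?case
    using B lt by (intro exI[of _ "insert z B"]) (auto dest!: bspec)
qed

lemma gauss_lobatto_set_card:
  assumes "K \<ge> 1"
  shows "finite (gauss_lobatto_set K)" "card (gauss_lobatto_set K) = Suc K"
    and "gauss_lobatto_set K \<subseteq> {-1..1}"
proof -
  define w :: "real poly" where "w = [:-1, 0, 1:]"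
  define Q where "Q k = (pderiv ^^ k) (w ^ K)" for k
  have Q_Suc: "Q (Suc k) = pderiv (Q k)" for k by (simp add: Q_def)
  have dvd: "w ^ (K - k) dvd Q k" if "k \<le> K" for k
    using that
  proof (induction k)
    case (Suc k)
    then obtain r where r: "Q k = w ^ Suc (K - Suc k) * r"
      by (metis Suc_diff_Suc Suc_leD Suc_le_lessD dvdE)
    have "w ^ (K - Suc k) dvd pderiv (w ^ Suc (K - Suc k) * r)"
      unfolding pderiv_mult pderiv_power_Suc by (intro dvd_add) (auto intro: dvd_mult dvd_mult2 dvd_smult)
    then show ?case by (simp add: Q_Suc r)
  qed (simp add: Q_def)
  have ends: "poly (Q k) 1 = 0" "poly (Q k) (-1) = 0" if "k < K" for k
  proof -
    have "w dvd Q k" using dvd[of k] that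
      by (metis dvd_power dvd_trans less_imp_le zero_less_diff)
    then show "poly (Q k) 1 = 0" "poly (Q k) (-1) = 0" by (auto simp: w_def elim!: dvdE)
  qed
  have roots: "\<exists>B. finite B \<and> card B = k \<and> B \<subseteq> {-1<..<1} \<and> (\<forall>b\<in>B. poly (Q k) b = 0)"
    if "k \<le> K" for k
    using that
  proof (induction k)
    case 0
    then show ?case by (intro exI[of _ "{}"]) auto
  next
    case (Suc k)
    then obtain B where B: "finite B" "card B = k" "B \<subseteq> {-1<..<1}" "\<forall>b\<in>B. poly (Q k) b = 0"
      by auto
    define A where "A = insert (-1) (insert 1 B)"
    have "1 \<notin> B" "-1 \<notin> B" using B by auto
    then have "card A = Suc (Suc k)" "finite A" using B by (auto simp: A_def)
    moreover have "\<forall>a\<in>A. poly (Q k) a = 0" using ends[of k] Suc.prems B by (auto simp: A_def)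
    ultimately obtain C where C: "finite C" "card C = Suc k"
      "\<forall>b\<in>C. poly (Q (Suc k)) b = 0 \<and> Min A < b \<and> b < Max A"
      using rolle_roots[of A "Suc k" "Q k"] unfolding Q_Suc by blast
    have "Min A = -1" by (rule Min_eqI) (use B in \<open>auto simp: A_def\<close>)
    moreover have "Max A = 1" by (rule Max_eqI) (use B in \<open>auto simp: A_def\<close>)
    ultimately show ?case using C by (intro exI[of _ C]) auto
  qed
  have degQ: "degree (Q k) = 2 * K - k" if "k \<le> K" for k
    using that by (induction k) (simp_all add: Q_def degree_pderiv degree_power_eq w_def)
  define D where "D = pderiv (legendre K)"
  have D: "D = smult (1 / (2 ^ K * fact K)) (pderiv (Q K))"
    by (simp add: D_def legendre_def Q_def w_def pderiv_smult)
  have degD: "degree D = K - 1"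
    using degQ[of K] by (simp add: D degree_pderiv)
  obtain B where B: "finite B" "card B = K" "B \<subseteq> {-1<..<1}" "\<forall>b\<in>B. poly (Q K) b = 0"
    using roots[of K] by auto
  obtain m where m: "K = Suc m" using assms by (cases K) auto
  obtain C where C: "finite C" "card C = m" "\<forall>b\<in>C. poly (pderiv (Q K)) b = 0 \<and> Min B < b \<and> b < Max B"
    using rolle_roots[of B m "Q K"] B m by blast
  have neB: "B \<noteq> {}" using B m by auto
  have "Min B \<in> B" "Max B \<in> B" using B neB by auto
  then have "-1 < Min B" "Max B < 1" using B(3) by auto
  then have C1: "C \<subseteq> {-1<..<1}" using C(3) by fastforce
  have nz: "D \<noteq> 0"
  proof
    assume "D = 0"
    then have "pderiv (Q K) = 0" by (simp add: D)
    then have "degree (Q K) = 0" by (simp add: pderiv_eq_0_iff)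
    then show False using degQ[of K] m by simp
  qed
  have fin: "finite {x. poly D x = 0}" using nz by (rule poly_roots_finite)
  have sub: "C \<subseteq> {x. poly D x = 0}" using C by (auto simp: D)
  have "card {x. poly D x = 0} \<le> m" using card_poly_roots_bound[OF nz] degD m by simp
  then have eq: "{x. poly D x = 0} = C" using card_seteq[OF fin sub] C by simp
  have "gauss_lobatto_set K = insert (-1) (insert 1 C)"
    by (auto simp: gauss_lobatto_set_def eq[symmetric] D_def)
  moreover have "1 \<notin> C" "-1 \<notin> C" using C1 by auto
  ultimately show "finite (gauss_lobatto_set K)" "card (gauss_lobatto_set K) = Suc K"
    "gauss_lobatto_set K \<subseteq> {-1..1}"
    using C C1 m by (auto simp: less_imp_le)
qed

lemma gauss_lobatto_strict_mono:
  assumes "K \<ge> 1" "k < l" "l \<le> K"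
  shows "gauss_lobatto K k < gauss_lobatto K l"
  unfolding gauss_lobatto_def
  by (rule sorted_wrt_nth_less[of "(<)"])
     (use assms gauss_lobatto_set_card[OF assms(1)] in auto)

lemma gauss_lobatto_image:
  assumes "K \<ge> 1"
  shows "gauss_lobatto K ` {..K} = gauss_lobatto_set K"
proof -
  have "set (sorted_list_of_set (gauss_lobatto_set K)) = gauss_lobatto_set K"
    using gauss_lobatto_set_card[OF assms] by simp
  moreover have "length (sorted_list_of_set (gauss_lobatto_set K)) = Suc K"
    using gauss_lobatto_set_card[OF assms] by simp
  ultimately show ?thesis
    by (auto simp: gauss_lobatto_def set_conv_nth image_iff less_Suc_eq_le)
qed

lemma gauss_lobatto_ends:
  assumes "K \<ge> 1"
  shows "gauss_lobatto K 0 = -1" "gauss_lobatto K K = 1"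
proof -
  note S = gauss_lobatto_set_card[OF assms] and im = gauss_lobatto_image[OF assms]
  have mono: "gauss_lobatto K k \<le> gauss_lobatto K l" if "k \<le> l" "l \<le> K" for k l
    using that gauss_lobatto_strict_mono[OF assms, of k l] by (cases "k = l") auto
  have rng: "gauss_lobatto K k \<in> {-1..1}" if "k \<le> K" for k
    using that S(3) im by blast
  have "-1 \<in> gauss_lobatto K ` {..K}" "1 \<in> gauss_lobatto K ` {..K}"
    unfolding im by (auto simp: gauss_lobatto_set_def)
  then obtain k l where "k \<le> K" "gauss_lobatto K k = -1" "l \<le> K" "gauss_lobatto K l = 1"
    by (metis (no_types, lifting) atMost_iff imageE)
  then show "gauss_lobatto K 0 = -1" "gauss_lobatto K K = 1"
    using mono[of 0 k] mono[of l K] rng[of 0] rng[of K] by auto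
qed

text \<open>A uniform one-dimensional grid on \<open>[origin, origin + len]\<close>; a Cartesian mesh is given by
  two of them, one per coordinate direction.\<close>

record grid =
  origin :: real
  len :: real
  cells :: nat

definition mesh_size :: "grid \<Rightarrow> real" where
  "mesh_size G = len G / real (cells G)"

definition grid_point :: "grid \<Rightarrow> nat \<Rightarrow> real" where
  "grid_point G l = origin G + real l * mesh_size G"

definition cell_node :: "nat \<Rightarrow> grid \<Rightarrow> nat \<Rightarrow> nat \<Rightarrow> real" where
  "cell_node K G l k = grid_point G l + mesh_size G * (1 + gauss_lobatto K k) / 2"

lemma cell_node_ends:
  assumes "K \<ge> 1"
  shows "cell_node K G l 0 = grid_point G l" "cell_node K G l K = grid_point G (Suc l)"
  using gauss_lobatto_ends[OF assms]
  by (auto simp: cell_node_def grid_point_def algebra_simps)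

definition mesh_domain :: "grid \<Rightarrow> grid \<Rightarrow> (real \<times> real) set" where
  "mesh_domain G1 G2 =
     {origin G1..origin G1 + len G1} \<times> {origin G2..origin G2 + len G2}"

definition element :: "grid \<Rightarrow> grid \<Rightarrow> nat \<Rightarrow> nat \<Rightarrow> (real \<times> real) set" where
  "element G1 G2 i j =
     {grid_point G1 i..grid_point G1 (Suc i)} \<times> {grid_point G2 j..grid_point G2 (Suc j)}"

definition mesh_nodes :: "nat \<Rightarrow> grid \<Rightarrow> grid \<Rightarrow> (real \<times> real) set" where
  "mesh_nodes K G1 G2 =
     {(cell_node K G1 i p, cell_node K G2 j q) | i j p q.
        i < cells G1 \<and> j < cells G2 \<and> p \<le> K \<and> q \<le> K}"

definition is_QK_on :: "nat \<Rightarrow> (real \<times> real) set \<Rightarrow> (real \<times> real \<Rightarrow> real) \<Rightarrow> bool" where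
  "is_QK_on K E u \<longleftrightarrow>
     (\<exists>c. \<forall>(x1, x2) \<in> E. u (x1, x2) = (\<Sum>k\<le>K. \<Sum>l\<le>K. c k l * x1 ^ k * x2 ^ l))"

text \<open>Functions are total, so membership in the spaces below only concerns the values on the
  closed domain.\<close>

definition fe_space :: "nat \<Rightarrow> grid \<Rightarrow> grid \<Rightarrow> (real \<times> real \<Rightarrow> real) set" where
  "fe_space K G1 G2 =
     {u. continuous_on (mesh_domain G1 G2) u \<and>
         (\<forall>i<cells G1. \<forall>j<cells G2. is_QK_on K (element G1 G2 i j) u)}"

definition fe_space_vec :: "nat \<Rightarrow> grid \<Rightarrow> grid \<Rightarrow> (real \<times> real \<Rightarrow> real ^ 's) set" where
  "fe_space_vec K G1 G2 = {u. \<forall>m. (\<lambda>x. u x $ m) \<in> fe_space K G1 G2}"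

definition nodal_interpolant ::
    "nat \<Rightarrow> grid \<Rightarrow> grid \<Rightarrow> (real \<times> real \<Rightarrow> real ^ 's) \<Rightarrow> (real \<times> real \<Rightarrow> real ^ 's) \<Rightarrow> bool" where
  "nodal_interpolant K G1 G2 v u \<longleftrightarrow>
     u \<in> fe_space_vec K G1 G2 \<and> (\<forall>x \<in> mesh_nodes K G1 G2. u x = v x)"

text \<open>The discrete potentials are the nodal interpolants of the following functions, which are
  themselves piecewise of degree \<open>K + 1\<close> in the direction of integration.\<close>

definition flux_potential1 :: "grid \<Rightarrow> (real \<times> real \<Rightarrow> real ^ 's) \<Rightarrow> real \<times> real \<Rightarrow> real ^ 's" where
  "flux_potential1 G2 F1h = (\<lambda>(a, b). integral {origin G2..b} (\<lambda>\<eta>. F1h (a, \<eta>)))"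

definition flux_potential2 :: "grid \<Rightarrow> (real \<times> real \<Rightarrow> real ^ 's) \<Rightarrow> real \<times> real \<Rightarrow> real ^ 's" where
  "flux_potential2 G1 F2h = (\<lambda>(a, b). integral {origin G1..a} (\<lambda>\<xi>. F2h (\<xi>, b)))"

definition source_potential ::
    "grid \<Rightarrow> grid \<Rightarrow> (real \<times> real \<Rightarrow> real ^ 's) \<Rightarrow> real \<times> real \<Rightarrow> real ^ 's" where
  "source_potential G1 G2 Sh =
     (\<lambda>(a, b). - integral {origin G1..a} (\<lambda>\<xi>. integral {origin G2..b} (\<lambda>\<eta>. Sh (\<xi>, \<eta>))))"

text \<open>For a finite element function the partial derivatives exist in the interior of every element;
  the unspecified values on element edges lie on a null set and do not affect the integrals below.\<close>

definition divergence ::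
    "(real \<times> real \<Rightarrow> real ^ 's) \<Rightarrow> (real \<times> real \<Rightarrow> real ^ 's) \<Rightarrow> real \<times> real \<Rightarrow> real ^ 's" where
  "divergence F1 F2 = (\<lambda>(x1, x2).
     vector_derivative (\<lambda>\<xi>. F1 (\<xi>, x2)) (at x1) + vector_derivative (\<lambda>\<eta>. F2 (x1, \<eta>)) (at x2))"

definition subcell_integral ::
    "nat \<Rightarrow> grid \<Rightarrow> grid \<Rightarrow> (real \<times> real \<Rightarrow> real ^ 's) \<Rightarrow> nat \<Rightarrow> nat \<Rightarrow> nat \<Rightarrow> nat \<Rightarrow> real ^ 's" where
  "subcell_integral K G1 G2 u i j p q =
     integral {cell_node K G2 j 0..cell_node K G2 j q} (\<lambda>x2.
       integral {cell_node K G1 i 0..cell_node K G1 i p} (\<lambda>x1. u (x1, x2)))"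

definition divergence_array ::
    "nat \<Rightarrow> grid \<Rightarrow> grid \<Rightarrow> (real \<times> real \<Rightarrow> real ^ 's) \<Rightarrow> (real \<times> real \<Rightarrow> real ^ 's) \<Rightarrow>
     nat \<Rightarrow> nat \<Rightarrow> nat \<Rightarrow> nat \<Rightarrow> real ^ 's" where
  "divergence_array K G1 G2 F1h F2h i j p q =
     subcell_integral K G1 G2 (divergence F1h F2h) i j p q"

definition source_array ::
    "nat \<Rightarrow> grid \<Rightarrow> grid \<Rightarrow> (real \<times> real \<Rightarrow> real ^ 's) \<Rightarrow>
     nat \<Rightarrow> nat \<Rightarrow> nat \<Rightarrow> nat \<Rightarrow> real ^ 's" where
  "source_array K G1 G2 Sh i j p q = - subcell_integral K G1 G2 Sh i j p q"

end

theory Submission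
  imports Defs
begin

text \<open>The mixed second difference of a function over the four corners of a subcell annihilates every
  sum \<open>f(x\<^sup>1) + g(x\<^sup>2)\<close>. Applied to the three potentials it gives, by additivity of the
  integral, the boundary fluxes and the source integral of the subcell, and by the fundamental theorem of
  calculus and Fubini the boundary fluxes add up to the integral of the divergence.\<close>

section \<open>Finite element functions: continuity and polynomial extension\<close>

lemma continuous_on_fe_space_vec:
  assumes "u \<in> fe_space_vec K G1 G2"
  shows "continuous_on (mesh_domain G1 G2) u"
proof -
  have "continuous_on (mesh_domain G1 G2) (\<lambda>x. \<chi> m. u x $ m)"
    using assms by (intro continuous_on_vec_lambda) (simp add: fe_space_vec_def fe_space_def)
  then show ?thesis by simp
qed

text \<open>On the closed element the function is a polynomial, and that polynomial makes sense on
  the whole plane. Replacing \<open>u\<close> by it provides two-sided derivatives up to the element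
  boundary, where \<open>u\<close> itself may have a kink, so the fundamental theorem of calculus
  applies to closed subcells touching the boundary.\<close>

lemma fe_space_vec_element_extension:
  fixes u :: "real \<times> real \<Rightarrow> real ^ 's"
  assumes "u \<in> fe_space_vec K G1 G2" "i < cells G1" "j < cells G2"
  obtains P D1 D2 :: "real \<times> real \<Rightarrow> real ^ 's" where
    "\<And>x. x \<in> element G1 G2 i j \<Longrightarrow> u x = P x"
    "\<And>x y. ((\<lambda>\<xi>. P (\<xi>, y)) has_vector_derivative D1 (x, y)) (at x)"
    "\<And>x y. ((\<lambda>\<eta>. P (x, \<eta>)) has_vector_derivative D2 (x, y)) (at y)"
    "continuous_on UNIV D1" "continuous_on UNIV D2"
proof -
  have "\<forall>m. \<exists>c. \<forall>x \<in> element G1 G2 i j.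
      u x $ m = (\<Sum>k\<le>K. \<Sum>l\<le>K. c k l * fst x ^ k * snd x ^ l)"
    using assms by (simp add: fe_space_vec_def fe_space_def is_QK_on_def case_prod_unfold)
  from choice[OF this] obtain C where C: "\<forall>m. \<forall>x \<in> element G1 G2 i j.
      u x $ m = (\<Sum>k\<le>K. \<Sum>l\<le>K. C m k l * fst x ^ k * snd x ^ l)"
    by (rule exE)
  \<comment> \<open>The coefficients of the separate components are bundled into vectors, so that
    one vector-valued polynomial represents all components at once.\<close>
  define c where "c k l = (\<chi> m. C m k l)" for k l
  define P where "P = (\<lambda>x. \<Sum>k\<le>K. \<Sum>l\<le>K. (fst x ^ k * snd x ^ l) *\<^sub>R c k l)"
  \<comment> \<open>The truncated exponents at \<open>k = 0\<close> here and at \<open>l = 0\<close>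
    in \<open>D2\<close> are harmless: the factor \<open>real k\<close> or \<open>real l\<close>
    makes those terms vanish.\<close>
  define D1 where
    "D1 = (\<lambda>x. \<Sum>k\<le>K. \<Sum>l\<le>K. (real k * fst x ^ (k - 1) * snd x ^ l) *\<^sub>R c k l)"
  define D2 where
    "D2 = (\<lambda>x. \<Sum>k\<le>K. \<Sum>l\<le>K. (fst x ^ k * (real l * snd x ^ (l - 1))) *\<^sub>R c k l)"
  show thesis
  proof
    show "u x = P x" if "x \<in> element G1 G2 i j" for x
      using C that by (simp add: vec_eq_iff P_def c_def ac_simps)
    have scale: "((\<lambda>t. f t *\<^sub>R v) has_vector_derivative f' *\<^sub>R v) (at t)"
      if "(f has_field_derivative f') (at t)" for f f' t and v :: "real ^ 's"
      using has_vector_derivative_scaleR[OF that has_vector_derivative_const[of v]] by simp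
    show "((\<lambda>\<xi>. P (\<xi>, y)) has_vector_derivative D1 (x, y)) (at x)" for x y
      unfolding P_def D1_def fst_conv snd_conv
      by (intro has_vector_derivative_sum scale) (auto intro!: derivative_eq_intros)
    show "((\<lambda>\<eta>. P (x, \<eta>)) has_vector_derivative D2 (x, y)) (at y)" for x y
      unfolding P_def D2_def fst_conv snd_conv
      by (intro has_vector_derivative_sum scale) (auto intro!: derivative_eq_intros)
    show "continuous_on UNIV D1" "continuous_on UNIV D2"
      unfolding D1_def D2_def by (intro continuous_intros)+
  qed
qed

section \<open>Location of nodes and cells in the grid\<close>

lemma cell_node_mem:
  assumes "K \<ge> 1" "len G > 0" "p \<le> K"
  shows "cell_node K G l p \<in> {grid_point G l..grid_point G (Suc l)}"
proof -
  have "gauss_lobatto K p \<in> {-1..1}"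
    using gauss_lobatto_image[OF assms(1)] gauss_lobatto_set_card(3)[OF assms(1)] assms(3) by blast
  moreover have "mesh_size G \<ge> 0"
    using assms(2) by (simp add: mesh_size_def)
  ultimately have "mesh_size G * (1 + gauss_lobatto K p) \<in> {0..mesh_size G * 2}"
    by (auto intro!: mult_nonneg_nonneg mult_left_mono)
  then show ?thesis
    by (auto simp: cell_node_def grid_point_def algebra_simps)
qed

lemma cell_subset_grid:
  assumes "len G > 0" "l < cells G"
  shows "{grid_point G l..grid_point G (Suc l)} \<subseteq> {origin G..origin G + len G}"
proof -
  have "real (Suc l) * mesh_size G \<le> real (cells G) * mesh_size G"
    using assms by (intro mult_right_mono) (auto simp: mesh_size_def)
  also have "\<dots> = len G"
    using assms by (simp add: mesh_size_def)
  finally have "grid_point G (Suc l) \<le> origin G + len G"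
    by (simp add: grid_point_def)
  moreover have "origin G \<le> grid_point G l"
    using assms by (simp add: grid_point_def mesh_size_def)
  ultimately show ?thesis by auto
qed

section \<open>Iterated integrals over rectangles\<close>

lemma continuous_on_section_fst:
  assumes "continuous_on (A \<times> B) u" "y \<in> B"
  shows "continuous_on A (\<lambda>x. u (x, y))"
  using assms by (intro continuous_on_compose2[OF assms(1)] continuous_intros) auto

lemma continuous_on_section_snd:
  assumes "continuous_on (A \<times> B) u" "x \<in> A"
  shows "continuous_on B (\<lambda>y. u (x, y))"
  using assms by (intro continuous_on_compose2[OF assms(1)] continuous_intros) auto

lemma continuous_on_integral_fst:
  fixes u :: "real \<times> real \<Rightarrow> 'a :: banach"
  assumes "continuous_on ({a0..a1} \<times> B) u"
  shows "continuous_on B (\<lambda>y. integral {a0..a1} (\<lambda>x. u (x, y)))"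
proof -
  \<comment> \<open>The coordinates are exchanged because
    \<open>integral_continuous_on_param\<close> expects the parameter first.\<close>
  have "continuous_on (B \<times> cbox a0 a1) (\<lambda>(y, x). u (x, y))"
    unfolding case_prod_unfold
    by (intro continuous_on_compose2[OF assms] continuous_intros) auto
  from integral_continuous_on_param[OF this] show ?thesis by simp
qed

lemma continuous_on_integral_snd:
  fixes u :: "real \<times> real \<Rightarrow> 'a :: banach"
  assumes "continuous_on (A \<times> {b0..b1}) u"
  shows "continuous_on A (\<lambda>x. integral {b0..b1} (\<lambda>y. u (x, y)))"
proof -
  have "continuous_on (A \<times> cbox b0 b1) (\<lambda>(x, y). u (x, y))"
    using assms by simp
  from integral_continuous_on_param[OF this] show ?thesis by simp
qed

lemma iterated_integral_swap:
  fixes u :: "real \<times> real \<Rightarrow> 'a :: banach"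
  assumes "continuous_on ({a0..a1} \<times> {b0..b1}) u"
  shows "integral {a0..a1} (\<lambda>x. integral {b0..b1} (\<lambda>y. u (x, y))) =
    integral {b0..b1} (\<lambda>y. integral {a0..a1} (\<lambda>x. u (x, y)))"
  using integral_swap_continuous[of a0 b0 a1 b1 "\<lambda>x y. u (x, y)"] assms
  by (simp add: cbox_Pair_eq)

text \<open>The sides of the rectangle contribute two end points to each one-dimensional integral, a
  negligible set. This removes the arbitrary values that \<open>vector_derivative\<close> may take
  on element edges.\<close>

lemma iterated_integral_cong_interior:
  fixes u v :: "real \<times> real \<Rightarrow> 'a :: banach"
  assumes "\<And>x y. x \<in> {a0<..<a1} \<Longrightarrow> y \<in> {b0<..<b1} \<Longrightarrow> u (x, y) = v (x, y)"
  shows "integral {b0..b1} (\<lambda>y. integral {a0..a1} (\<lambda>x. u (x, y))) =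
    integral {b0..b1} (\<lambda>y. integral {a0..a1} (\<lambda>x. v (x, y)))"
proof (rule integral_spike[of "{b0, b1}"])
  fix y assume y: "y \<in> {b0..b1} - {b0, b1}"
  show "integral {a0..a1} (\<lambda>x. v (x, y)) = integral {a0..a1} (\<lambda>x. u (x, y))"
    by (rule integral_spike[of "{a0, a1}"]) (use y assms in auto)
qed simp

lemma iterated_integral_add:
  fixes u v :: "real \<times> real \<Rightarrow> 'a :: banach"
  assumes u: "continuous_on ({a0..a1} \<times> {b0..b1}) u"
    and v: "continuous_on ({a0..a1} \<times> {b0..b1}) v"
  shows "integral {b0..b1} (\<lambda>y. integral {a0..a1} (\<lambda>x. u (x, y) + v (x, y))) =
    integral {b0..b1} (\<lambda>y. integral {a0..a1} (\<lambda>x. u (x, y))) +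
    integral {b0..b1} (\<lambda>y. integral {a0..a1} (\<lambda>x. v (x, y)))"
proof -
  have "integral {b0..b1} (\<lambda>y. integral {a0..a1} (\<lambda>x. u (x, y) + v (x, y))) =
    integral {b0..b1} (\<lambda>y. integral {a0..a1} (\<lambda>x. u (x, y)) + integral {a0..a1} (\<lambda>x. v (x, y)))"
    by (intro integral_cong integral_add integrable_continuous_real
        continuous_on_section_fst[OF u] continuous_on_section_fst[OF v])
  also have "\<dots> = integral {b0..b1} (\<lambda>y. integral {a0..a1} (\<lambda>x. u (x, y))) +
    integral {b0..b1} (\<lambda>y. integral {a0..a1} (\<lambda>x. v (x, y)))"
    by (intro integral_add integrable_continuous_real
        continuous_on_integral_fst[OF u] continuous_on_integral_fst[OF v])
  finally show ?thesis .
qed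

text \<open>Divergence theorem on a rectangle: each derivative is integrated first in its own
  variable by the fundamental theorem of calculus, which for \<open>D2\<close> requires exchanging
  the order of integration.\<close>

lemma iterated_integral_divergence:
  fixes P Q D1 D2 :: "real \<times> real \<Rightarrow> 'a :: banach"
  assumes ab: "a0 \<le> a1" "b0 \<le> b1"
    and P: "\<And>x y. ((\<lambda>\<xi>. P (\<xi>, y)) has_vector_derivative D1 (x, y)) (at x)"
    and Q: "\<And>x y. ((\<lambda>\<eta>. Q (x, \<eta>)) has_vector_derivative D2 (x, y)) (at y)"
    and cont: "continuous_on UNIV D1" "continuous_on UNIV D2"
  shows "integral {b0..b1} (\<lambda>y. integral {a0..a1} (\<lambda>x. D1 (x, y) + D2 (x, y))) =
    integral {b0..b1} (\<lambda>y. P (a1, y) - P (a0, y)) +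
    integral {a0..a1} (\<lambda>x. Q (x, b1) - Q (x, b0))"
proof -
  have c: "continuous_on ({a0..a1} \<times> {b0..b1}) D1" "continuous_on ({a0..a1} \<times> {b0..b1}) D2"
    using cont by (auto intro: continuous_on_subset)
  have 1: "integral {a0..a1} (\<lambda>x. D1 (x, y)) = P (a1, y) - P (a0, y)" for y
    using fundamental_theorem_of_calculus[OF ab(1) has_vector_derivative_at_within[OF P]]
    by (rule integral_unique)
  have 2: "integral {b0..b1} (\<lambda>y. D2 (x, y)) = Q (x, b1) - Q (x, b0)" for x
    using fundamental_theorem_of_calculus[OF ab(2) has_vector_derivative_at_within[OF Q]]
    by (rule integral_unique)
  show ?thesis
    \<comment> \<open>Both \<open>D2\<close> terms meet at the integral with \<open>y\<close>
      innermost: the left one by the exchange, the boundary term by reading \<open>2\<close>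
      backwards.\<close>
    by (simp add: iterated_integral_add[OF c] 1 flip: iterated_integral_swap[OF c(2)] 2)
qed

text \<open>\<open>J\<close> is the source potential up to sign, anchored at the domain corner. The
  difference in \<open>a\<close> leaves a vertical strip and the difference in \<open>b\<close> cuts
  the subcell out of it; additivity of the integral is used once in each variable.\<close>

lemma iterated_integral_increment:
  fixes u :: "real \<times> real \<Rightarrow> 'a :: banach"
  assumes u: "continuous_on ({o1..e1} \<times> {o2..e2}) u"
    and a: "o1 \<le> a0" "a0 \<le> a1" "a1 \<le> e1" and b: "o2 \<le> b0" "b0 \<le> b1" "b1 \<le> e2"
  defines "J \<equiv> \<lambda>a b. integral {o1..a} (\<lambda>x. integral {o2..b} (\<lambda>y. u (x, y)))"
  shows "(J a1 b1 - J a0 b1) - (J a1 b0 - J a0 b0) =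
    integral {b0..b1} (\<lambda>y. integral {a0..a1} (\<lambda>x. u (x, y)))"
proof -
  have c: "continuous_on ({o1..a} \<times> {o2..b}) u" if "a \<le> e1" "b \<le> e2" for a b
    using that by (intro continuous_on_subset[OF u]) auto
  have J: "J a1 b - J a0 b = integral {a0..a1} (\<lambda>x. integral {o2..b} (\<lambda>y. u (x, y)))"
    if "b \<le> e2" for b
    using Henstock_Kurzweil_Integration.integral_combine[OF a(1,2) integrable_continuous_real[OF continuous_on_integral_snd[OF c]]]
      a that by (simp add: J_def algebra_simps)
  have i: "(\<lambda>x. integral {o2..b} (\<lambda>y. u (x, y))) integrable_on {a0..a1}" if "b \<le> e2" for b
    by (intro integrable_continuous_real continuous_on_integral_snd continuous_on_subset[OF u])
       (use a b that in auto)
  have "(J a1 b1 - J a0 b1) - (J a1 b0 - J a0 b0) = integral {a0..a1} (\<lambda>x.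
      integral {o2..b1} (\<lambda>y. u (x, y)) - integral {o2..b0} (\<lambda>y. u (x, y)))"
    using b by (simp add: J integral_diff i)
  also have "\<dots> = integral {a0..a1} (\<lambda>x. integral {b0..b1} (\<lambda>y. u (x, y)))"
  proof (rule integral_cong)
    fix x assume x: "x \<in> {a0..a1}"
    have "(\<lambda>y. u (x, y)) integrable_on {o2..b1}"
      by (intro integrable_continuous_real continuous_on_section_snd[OF c[of a1]]) (use a b x in auto)
    from Henstock_Kurzweil_Integration.integral_combine[OF b(1,2) this]
    show "integral {o2..b1} (\<lambda>y. u (x, y)) - integral {o2..b0} (\<lambda>y. u (x, y)) =
        integral {b0..b1} (\<lambda>y. u (x, y))"
      by (simp add: algebra_simps)
  qed
  also have "\<dots> = integral {b0..b1} (\<lambda>y. integral {a0..a1} (\<lambda>x. u (x, y)))"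
    by (intro iterated_integral_swap continuous_on_subset[OF u]) (use a b in auto)
  finally show ?thesis .
qed

section \<open>The divergence on one element\<close>

text \<open>\<open>D\<close> is built from the polynomial extensions of \<open>F1\<close> and
  \<open>F2\<close>, hence is continuous across the element edges, where \<open>divergence\<close>
  has no reliable value. The boundary fluxes can still be written with \<open>F1\<close> and
  \<open>F2\<close>, since these agree with their extensions on the closed element.\<close>

lemma divergence_continuous_extension:
  fixes F1 F2 :: "real \<times> real \<Rightarrow> real ^ 's"
  assumes "i < cells G1" "j < cells G2"
    and F: "F1 \<in> fe_space_vec K G1 G2" "F2 \<in> fe_space_vec K G1 G2"
  obtains D :: "real \<times> real \<Rightarrow> real ^ 's" where
    "continuous_on UNIV D"
    "\<And>x. x \<in> interior (element G1 G2 i j) \<Longrightarrow> divergence F1 F2 x = D x"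
    "\<And>a0 a1 b0 b1. grid_point G1 i \<le> a0 \<Longrightarrow> a0 \<le> a1 \<Longrightarrow> a1 \<le> grid_point G1 (Suc i) \<Longrightarrow>
       grid_point G2 j \<le> b0 \<Longrightarrow> b0 \<le> b1 \<Longrightarrow> b1 \<le> grid_point G2 (Suc j) \<Longrightarrow>
       integral {b0..b1} (\<lambda>y. integral {a0..a1} (\<lambda>x. D (x, y))) =
       integral {b0..b1} (\<lambda>y. F1 (a1, y) - F1 (a0, y)) +
       integral {a0..a1} (\<lambda>x. F2 (x, b1) - F2 (x, b0))"
proof -
  \<comment> \<open>Only the first partial derivative of the extension of \<open>F1\<close> and the
    second one of the extension of \<open>F2\<close> enter the divergence.\<close>
  let ?E = "element G1 G2 i j"
  obtain P D1 where P: "\<And>x. x \<in> ?E \<Longrightarrow> F1 x = P x"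
    "\<And>x y. ((\<lambda>\<xi>. P (\<xi>, y)) has_vector_derivative D1 (x, y)) (at x)"
    "continuous_on UNIV D1"
    by (rule fe_space_vec_element_extension[OF F(1) assms(1,2)]) blast
  obtain Q D2 where Q: "\<And>x. x \<in> ?E \<Longrightarrow> F2 x = Q x"
    "\<And>x y. ((\<lambda>\<eta>. Q (x, \<eta>)) has_vector_derivative D2 (x, y)) (at y)"
    "continuous_on UNIV D2"
    by (rule fe_space_vec_element_extension[OF F(2) assms(1,2)]) blast
  show thesis
  proof
    show "continuous_on UNIV (\<lambda>x. D1 x + D2 x)"
      using P(3) Q(3) by (rule continuous_on_add)
    show "divergence F1 F2 z = D1 z + D2 z" if "z \<in> interior ?E" for z
    proof -
      obtain x y where z: "z = (x, y)" by force
      have x: "x \<in> {grid_point G1 i<..<grid_point G1 (Suc i)}"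
        and y: "y \<in> {grid_point G2 j<..<grid_point G2 (Suc j)}"
        using that by (auto simp: z element_def interior_Times)
      \<comment> \<open>Along each coordinate line through an interior point, the function and its
        extension agree on an open interval around the point, so the derivative carries
        over.\<close>
      have "((\<lambda>\<xi>. F1 (\<xi>, y)) has_vector_derivative D1 (x, y)) (at x)"
        by (rule has_vector_derivative_transform_within_open[OF P(2) _ x])
           (use y in \<open>auto simp: P(1) element_def\<close>)
      moreover have "((\<lambda>\<eta>. F2 (x, \<eta>)) has_vector_derivative D2 (x, y)) (at y)"
        by (rule has_vector_derivative_transform_within_open[OF Q(2) _ y])
           (use x in \<open>auto simp: Q(1) element_def\<close>)
      ultimately show ?thesis
        by (simp add: z divergence_def vector_derivative_at)
    qed
    fix a0 a1 b0 b1
    assume ab: "grid_point G1 i \<le> a0" "a0 \<le> a1" "a1 \<le> grid_point G1 (Suc i)"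
      "grid_point G2 j \<le> b0" "b0 \<le> b1" "b1 \<le> grid_point G2 (Suc j)"
    have "integral {b0..b1} (\<lambda>y. P (a1, y) - P (a0, y)) =
        integral {b0..b1} (\<lambda>y. F1 (a1, y) - F1 (a0, y))"
      by (rule integral_cong) (use ab in \<open>auto simp: P(1) element_def\<close>)
    moreover have "integral {a0..a1} (\<lambda>x. Q (x, b1) - Q (x, b0)) =
        integral {a0..a1} (\<lambda>x. F2 (x, b1) - F2 (x, b0))"
      by (rule integral_cong) (use ab in \<open>auto simp: Q(1) element_def\<close>)
    ultimately show "integral {b0..b1} (\<lambda>y. integral {a0..a1} (\<lambda>x. D1 (x, y) + D2 (x, y))) =
        integral {b0..b1} (\<lambda>y. F1 (a1, y) - F1 (a0, y)) +
        integral {a0..a1} (\<lambda>x. F2 (x, b1) - F2 (x, b0))"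
      by (simp only: iterated_integral_divergence[OF ab(2,5) P(2) Q(2) P(3) Q(3)])
  qed
qed

section \<open>The discrete balance on a subcell\<close>

theorem proposition11:
  fixes K :: nat and G1 G2 :: grid
    and F1 F2 :: "real ^ 's \<Rightarrow> real ^ 's"
    and S :: "real ^ 's \<Rightarrow> real \<times> real \<Rightarrow> real ^ 's"
    and Wh F1h F2h Sh PF1h PF2h PSh :: "real \<times> real \<Rightarrow> real ^ 's"
    and fh gh :: "real \<Rightarrow> real ^ 's"
  assumes "K \<ge> 1"
    and "len G1 > 0" and "len G2 > 0" and "cells G1 \<ge> 1" and "cells G2 \<ge> 1"
    and "Wh \<in> fe_space_vec K G1 G2"
    and "nodal_interpolant K G1 G2 (\<lambda>x. F1 (Wh x)) F1h"
    and "nodal_interpolant K G1 G2 (\<lambda>x. F2 (Wh x)) F2h"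
    and "nodal_interpolant K G1 G2 (\<lambda>x. S (Wh x) x) Sh"
    and "nodal_interpolant K G1 G2 (flux_potential1 G2 F1h) PF1h"
    and "nodal_interpolant K G1 G2 (flux_potential2 G1 F2h) PF2h"
    and "nodal_interpolant K G1 G2 (source_potential G1 G2 Sh) PSh"
    and "\<And>x2. x2 \<in> {origin G2..origin G2 + len G2} \<Longrightarrow> gh x2 = PF1h (origin G1, x2)"
    and "\<And>x1. x1 \<in> {origin G1..origin G1 + len G1} \<Longrightarrow> fh x1 = PF2h (x1, origin G2)"
    and "\<And>x1 x2. (x1, x2) \<in> mesh_nodes K G1 G2 \<Longrightarrow>
           PF1h (x1, x2) + PF2h (x1, x2) + PSh (x1, x2) = fh x1 + gh x2"
  shows "\<forall>i<cells G1. \<forall>j<cells G2. \<forall>p\<le>K. \<forall>q\<le>K.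
           divergence_array K G1 G2 F1h F2h i j p q + source_array K G1 G2 Sh i j p q = 0 \<and>
           subcell_integral K G1 G2 (\<lambda>x. divergence F1h F2h x - Sh x) i j p q = 0"
proof (intro allI impI)
  fix i j p q
  assume i: "i < cells G1" and j: "j < cells G2" and p: "p \<le> K" and q: "q \<le> K"
  \<comment> \<open>The subcell is the rectangle from \<open>(a0, b0)\<close>, the lower left corner
    of the element, to \<open>(a1, b1)\<close>. It degenerates when \<open>p = 0\<close> or
    \<open>q = 0\<close>, so only weak inequalities between its ends are available.\<close>
  define a0 where "a0 = cell_node K G1 i 0"
  define a1 where "a1 = cell_node K G1 i p"
  define b0 where "b0 = cell_node K G2 j 0"
  define b1 where "b1 = cell_node K G2 j q"
  note o_le = cell_subset_grid[OF \<open>len G1 > 0\<close> i] cell_subset_grid[OF \<open>len G2 > 0\<close> j]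
  have cell: "grid_point G1 i \<le> a0" "a0 \<le> a1" "a1 \<le> grid_point G1 (Suc i)"
    "grid_point G2 j \<le> b0" "b0 \<le> b1" "b1 \<le> grid_point G2 (Suc j)"
    using cell_node_mem[OF \<open>K \<ge> 1\<close> \<open>len G1 > 0\<close> p, of i]
      cell_node_mem[OF \<open>K \<ge> 1\<close> \<open>len G2 > 0\<close> q, of j]
    by (auto simp: a0_def a1_def b0_def b1_def cell_node_ends[OF \<open>K \<ge> 1\<close>])
  have grid: "origin G1 \<le> a0" "a1 \<le> origin G1 + len G1"
    "origin G2 \<le> b0" "b1 \<le> origin G2 + len G2"
    using o_le cell by auto
  have F: "F1h \<in> fe_space_vec K G1 G2" "F2h \<in> fe_space_vec K G1 G2" "Sh \<in> fe_space_vec K G1 G2"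
    using assms(7-9) by (auto simp: nodal_interpolant_def)
  note cont = continuous_on_fe_space_vec[OF F(1), unfolded mesh_domain_def]
    continuous_on_fe_space_vec[OF F(2), unfolded mesh_domain_def]
    continuous_on_fe_space_vec[OF F(3), unfolded mesh_domain_def]
  \<comment> \<open>\<open>A a\<close> and \<open>B b\<close> are the fluxes through a vertical and
    a horizontal segment of the subcell. As increments of the flux potentials they no longer depend
    on the lower limits at the domain origin.\<close>
  define A where "A a = integral {b0..b1} (\<lambda>y. F1h (a, y))" for a
  define B where "B b = integral {a0..a1} (\<lambda>x. F2h (x, b))" for b
  have A: "flux_potential1 G2 F1h (a, b1) - flux_potential1 G2 F1h (a, b0) = A a"
    and Ai: "(\<lambda>y. F1h (a, y)) integrable_on {b0..b1}"
    if "a \<in> {a0..a1}" for a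
  proof -
    have c: "continuous_on {origin G2..origin G2 + len G2} (\<lambda>y. F1h (a, y))"
      by (rule continuous_on_section_snd[OF cont(1)]) (use that cell grid in auto)
    show "(\<lambda>y. F1h (a, y)) integrable_on {b0..b1}"
      by (intro integrable_continuous_real continuous_on_subset[OF c]) (use cell grid in auto)
    have "(\<lambda>y. F1h (a, y)) integrable_on {origin G2..b1}"
      by (intro integrable_continuous_real continuous_on_subset[OF c]) (use cell grid in auto)
    from Henstock_Kurzweil_Integration.integral_combine[OF grid(3) cell(5) this]
    show "flux_potential1 G2 F1h (a, b1) - flux_potential1 G2 F1h (a, b0) = A a"
      by (simp add: flux_potential1_def A_def algebra_simps)
  qed
  have B: "flux_potential2 G1 F2h (a1, b) - flux_potential2 G1 F2h (a0, b) = B b"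
    and Bi: "(\<lambda>x. F2h (x, b)) integrable_on {a0..a1}"
    if "b \<in> {b0..b1}" for b
  proof -
    have c: "continuous_on {origin G1..origin G1 + len G1} (\<lambda>x. F2h (x, b))"
      by (rule continuous_on_section_fst[OF cont(2)]) (use that cell grid in auto)
    show "(\<lambda>x. F2h (x, b)) integrable_on {a0..a1}"
      by (intro integrable_continuous_real continuous_on_subset[OF c]) (use cell grid in auto)
    have "(\<lambda>x. F2h (x, b)) integrable_on {origin G1..a1}"
      by (intro integrable_continuous_real continuous_on_subset[OF c]) (use cell grid in auto)
    from Henstock_Kurzweil_Integration.integral_combine[OF grid(1) cell(2) this]
    show "flux_potential2 G1 F2h (a1, b) - flux_potential2 G1 F2h (a0, b) = B b"
      by (simp add: flux_potential2_def B_def algebra_simps)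
  qed
  \<comment> \<open>The outer minus sign undoes the one in the definition of the source
    potential.\<close>
  have S: "- ((source_potential G1 G2 Sh (a1, b1) - source_potential G1 G2 Sh (a0, b1)) -
      (source_potential G1 G2 Sh (a1, b0) - source_potential G1 G2 Sh (a0, b0))) =
      subcell_integral K G1 G2 Sh i j p q"
    using iterated_integral_increment[OF cont(3) grid(1) cell(2) grid(2,3) cell(5) grid(4)]
    by (simp add: source_potential_def subcell_integral_def a0_def a1_def b0_def b1_def
        algebra_simps)
  \<comment> \<open>All four corners of the subcell are mesh nodes. There the interpolants
    \<open>PF1h\<close>, \<open>PF2h\<close> and \<open>PSh\<close> take the values of the exact
    integrals, so the nodal hypothesis passes to the integrals themselves.\<close>
  have balance: "flux_potential1 G2 F1h (a, b) + flux_potential2 G1 F2h (a, b) +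
      source_potential G1 G2 Sh (a, b) = fh a + gh b"
    if "a = a0 \<or> a = a1" "b = b0 \<or> b = b1" for a b
  proof -
    have "(a, b) \<in> mesh_nodes K G1 G2"
      using that i j p q unfolding mesh_nodes_def a0_def a1_def b0_def b1_def by blast
    then show ?thesis
      using assms(10-12,15) by (simp add: nodal_interpolant_def)
  qed
  have key: "(A a1 - A a0) + (B b1 - B b0) = subcell_integral K G1 G2 Sh i j p q"
  proof -
    \<comment> \<open>The right-hand side is the mixed second difference of \<open>fh + gh\<close>,
      left unsimplified so that \<open>balance\<close> can turn each bracket into potentials at a
      corner. Afterwards it is zero because every term occurs with both signs.\<close>
    have "(A a1 - A a0) + (B b1 - B b0) - subcell_integral K G1 G2 Sh i j p q =
        ((fh a1 + gh b1) - (fh a0 + gh b1)) - ((fh a1 + gh b0) - (fh a0 + gh b0))"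
      using cell by (simp flip: balance A B S)
    then show ?thesis by simp
  qed
  obtain D where D: "continuous_on UNIV D"
    "\<And>x. x \<in> interior (element G1 G2 i j) \<Longrightarrow> divergence F1h F2h x = D x"
    "integral {b0..b1} (\<lambda>y. integral {a0..a1} (\<lambda>x. D (x, y))) =
       integral {b0..b1} (\<lambda>y. F1h (a1, y) - F1h (a0, y)) +
       integral {a0..a1} (\<lambda>x. F2h (x, b1) - F2h (x, b0))"
    by (rule divergence_continuous_extension[OF i j F(1,2)]) (rule that, assumption+, use cell in blast)
  \<comment> \<open>The open subcell lies in the interior of the element.\<close>
  have D_eq: "divergence F1h F2h (x, y) = D (x, y)" if "x \<in> {a0<..<a1}" "y \<in> {b0<..<b1}" for x y
    using that cell by (intro D(2)) (auto simp: element_def interior_Times)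
  have "integral {b0..b1} (\<lambda>y. integral {a0..a1} (\<lambda>x. D (x, y))) =
      subcell_integral K G1 G2 Sh i j p q"
    using cell key by (simp add: D(3) integral_diff Ai Bi A_def B_def)
  moreover have "subcell_integral K G1 G2 (divergence F1h F2h) i j p q =
      integral {b0..b1} (\<lambda>y. integral {a0..a1} (\<lambda>x. D (x, y)))"
    unfolding subcell_integral_def a0_def[symmetric] a1_def[symmetric] b0_def[symmetric] b1_def[symmetric]
    by (rule iterated_integral_cong_interior) (rule D_eq)
  moreover have "subcell_integral K G1 G2 (\<lambda>x. divergence F1h F2h x - Sh x) i j p q =
      integral {b0..b1} (\<lambda>y. integral {a0..a1} (\<lambda>x. D (x, y))) -
      subcell_integral K G1 G2 Sh i j p q"
  proof -
    have cD: "continuous_on ({a0..a1} \<times> {b0..b1}) D"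
      using D(1) by (rule continuous_on_subset) simp
    have cS: "continuous_on ({a0..a1} \<times> {b0..b1}) (\<lambda>x. - Sh x)"
      by (intro continuous_on_minus continuous_on_subset[OF cont(3)]) (use cell grid in auto)
    \<comment> \<open>The divergence is exchanged for \<open>D\<close> before the integral is split,
      since additivity is available for continuous integrands; the difference is written as a sum
      with \<open>- Sh\<close> to match it.\<close>
    have "subcell_integral K G1 G2 (\<lambda>x. divergence F1h F2h x - Sh x) i j p q =
        integral {b0..b1} (\<lambda>y. integral {a0..a1} (\<lambda>x. (\<lambda>z. D z + - Sh z) (x, y)))"
      unfolding subcell_integral_def a0_def[symmetric] a1_def[symmetric] b0_def[symmetric] b1_def[symmetric]
      by (rule iterated_integral_cong_interior) (simp add: D_eq)
    then show ?thesis
      using iterated_integral_add[OF cD cS]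
      by (simp add: subcell_integral_def a0_def a1_def b0_def b1_def)
  qed
  ultimately show "divergence_array K G1 G2 F1h F2h i j p q + source_array K G1 G2 Sh i j p q = 0 \<and>
      subcell_integral K G1 G2 (\<lambda>x. divergence F1h F2h x - Sh x) i j p q = 0"
    by (simp add: divergence_array_def source_array_def)
qed

end
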